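(* The continued fraction \[ 36+\cfrac{324}{33-\cfrac{9\cdot3^4}{40\cdot2^2+2-\cfrac{9\cdot5^4}{40\cdot3^2+2-\cdots}}}, \] i.e. with $a(0)=36$, $a(1)=33$, $a(n)=40n^2+2$ for $n\ge2$, $b(0)=324$, $b(n)=-9(2n+1)^4$ for $n\ge1$, converges to $2^{-1/3}\big(\Gamma(1/3)/\Gamma(2/3)\big)^6$. Moreover, with $p(n)/q(n)$ its $n$-th convergent, as $n\to\infty$ \[ 2^{-1/3}\Big(\frac{\Gamma(1/3)}{\Gamma(2/3)}\Big)^6-\frac{p(n)}{q(n)}\sim\frac{4\cdot2^{-1/3}(\Gamma(1/3)/\Gamma(2/3))^6}{3^{2n+2}}. \]
   Context: For sequences $a(n),b(n)$, the continued fraction is $a(0)+\cfrac{b(0)}{a(1)+\cfrac{b(1)}{a(2)+\cdots}}$ and its $n$-th convergent $p(n)/q(n)$ is the truncation ending with $b(n-1)/a(n)$. *)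

theory Defs
  imports "HOL-Analysis.Analysis"
begin

text \<open>Generic truncated continued fraction:
  cf_tail a b k m = a k + b k / (a (k+1) + b (k+1) / ( ... + b (k+m-1) / a (k+m))).
  The n-th convergent p(n)/q(n) of a(0) + b(0)/(a(1) + b(1)/(a(2) + ...)) is
  cf_tail a b 0 n (the truncation ending with b(n-1)/a(n)).\<close>
fun cf_tail :: "(nat \<Rightarrow> real) \<Rightarrow> (nat \<Rightarrow> real) \<Rightarrow> nat \<Rightarrow> nat \<Rightarrow> real" where
  "cf_tail a b k 0 = a k"
| "cf_tail a b k (Suc m) = a k + b k / cf_tail a b (Suc k) m"

definition cf_convergent :: "(nat \<Rightarrow> real) \<Rightarrow> (nat \<Rightarrow> real) \<Rightarrow> nat \<Rightarrow> real" where
  "cf_convergent a b n = cf_tail a b 0 n"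

definition a41 :: "nat \<Rightarrow> real" where
  "a41 n = (if n = 0 then 36 else if n = 1 then 33 else 40 * (real n)^2 + 2)"

definition b41 :: "nat \<Rightarrow> real" where
  "b41 n = (if n = 0 then 324 else - 9 * (2 * real n + 1)^4)"

end

theory Submission
  imports Defs "HOL-Real_Asymp.Real_Asymp"
begin

text \<open>
  After division by the squares of the double factorials (2n+1)!!, the recurrence of the convergents
  is the Apery-like recurrence (s+1)^2 u(s+1) = (10 s^2 + 10 s + 3) u(s) - 9 s^2 u(s-1) of the numbers
  Sum_k C(s,k)^2 C(2k,k), taken at half-integers s. Its minimal solution is a multiple of
  3F2(1/2, 1/2, 1/2; n+1, n+1; 1/4), which decays like 1/n. The Casoratian then gives both the
  convergence and the size of the error in terms of the first two values of the minimal solution.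
  These reduce to 3F2(1/2, 1/2, 1/2; 1, 1; 1/4) and 3F2(5/2, 1/2, 1/2; 2, 2; 1/4), which are evaluated
  by a WZ pair: the family F(N) = 3F2(1/2 + 2N, 1/2, 1/2; 1 + N, 1 + N; 1/4) satisfies
  F(N+3) = rho(N) F(N) with rational rho, and F(N) tends to 1.
\<close>

section \<open>Hypergeometric sums at one quarter\<close>

text \<open>Term of 3F2(a, 1/2, 1/2; d, d; 1/4). Both families needed have this shape:
  \<open>a = 1/2\<close>, \<open>d = 1 + n\<close> for the minimal solution, and
  \<open>a = 1/2 + 2 N\<close>, \<open>d = 1 + N\<close> for F(N).\<close>

definition hterm :: "real \<Rightarrow> real \<Rightarrow> nat \<Rightarrow> real" where
  "hterm a d k = pochhammer a k * pochhammer (1/2) k ^ 2 / (pochhammer d k ^ 2 * fact k * 4 ^ k)"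

definition hsum :: "real \<Rightarrow> real \<Rightarrow> real" where
  "hsum a d = (\<Sum>k. hterm a d k)"

lemma hterm_0 [simp]: "hterm a d 0 = 1"
  by (simp add: hterm_def)

lemma hterm_pos: "a > 0 \<Longrightarrow> d > 0 \<Longrightarrow> hterm a d k > 0"
  unfolding hterm_def by (intro divide_pos_pos mult_pos_pos zero_less_power pochhammer_pos) auto

lemma hterm_Suc:
  "hterm a d (Suc k) =
     hterm a d k * ((a + k) * (1/2 + k) ^ 2 / (4 * (real k + 1) * (d + k) ^ 2))"
  unfolding hterm_def by (simp add: pochhammer_Suc power_mult_distrib ac_simps)

text \<open>In the term ratio, a + k is at most 2 (d + k), while the two factors 1/2 + k are at most
  k + 1 and d + k; the 4 in the denominator leaves 1/2.\<close>

lemma hterm_Suc_le: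
  assumes "a > 0" "d \<ge> 1" "a \<le> 2 * d"
  shows "hterm a d (Suc k) \<le> hterm a d k * (1/2)"
proof -
  have "(a + k) * ((1/2 + real k) * (1/2 + k)) \<le> (2 * (d + k)) * ((real k + 1) * (d + k))"
    using assms by (intro mult_mono) auto
  then have "(a + k) * (1/2 + k) ^ 2 / (4 * (real k + 1) * (d + k) ^ 2) \<le> 1/2"
    using assms by (subst pos_divide_le_eq) (auto simp: power2_eq_square algebra_simps add_pos_nonneg)
  then show ?thesis
    unfolding hterm_Suc using hterm_pos[of a d k] assms by (intro mult_left_mono) auto
qed

text \<open>The first term after the leading 1 is a / (16 d^2), at most 1 / (8 d); the others halve
  at each step. The factor 1/d is what makes the sum tend to 1 as d grows, even when a grows along
  with it.\<close>

lemma hterm_Suc_bound: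
  assumes "a > 0" "d \<ge> 1" "a \<le> 2 * d"
  shows "hterm a d (Suc k) \<le> (1/2) ^ k / (8 * d)"
proof (induction k)
  case 0
  have "a / (16 * d ^ 2) \<le> (2 * d) / (16 * d ^ 2)"
    using assms by (intro divide_right_mono) auto
  also have "\<dots> = 1 / (8 * d)"
    using assms by (simp add: power2_eq_square)
  finally show ?case by (simp add: hterm_Suc power2_eq_square)
next
  case (Suc k)
  then show ?case using hterm_Suc_le[OF assms, of "Suc k"] by simp
qed

lemma
  assumes "a > 0" "d \<ge> 1" "a \<le> 2 * d"
  shows summable_hterm: "summable (hterm a d)"
    and hsum_ge_1: "hsum a d \<ge> 1"
    and hsum_le: "hsum a d \<le> 1 + 1 / (4 * d)"
proof -
  have g: "(\<lambda>k. (1/2) ^ k / (8 * d)) sums (2 / (8 * d))"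
    using sums_divide[OF geometric_sums[of "1/2::real"], of "8 * d"] by simp
  have nn: "hterm a d k \<ge> 0" for k
    using hterm_pos[of a d k] assms by simp
  have s: "summable (\<lambda>k. hterm a d (Suc k))"
    by (rule summable_comparison_test_ev[OF _ sums_summable[OF g]])
       (use hterm_Suc_bound[OF assms] nn in auto)
  then show summ: "summable (hterm a d)"
    by (simp add: summable_Suc_iff)
  have eq: "hsum a d = 1 + (\<Sum>k. hterm a d (Suc k))"
    unfolding hsum_def using suminf_split_head[OF summ] by simp
  have "(\<Sum>k. hterm a d (Suc k)) \<le> 2 / (8 * d)"
    using suminf_le[OF hterm_Suc_bound[OF assms] s sums_summable[OF g]] sums_unique[OF g] by simp
  then show "hsum a d \<le> 1 + 1 / (4 * d)"
    unfolding eq by simp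
  show "hsum a d \<ge> 1"
    unfolding eq using suminf_nonneg[OF s] nn by simp
qed

lemma tendsto_hsum_1:
  assumes "\<And>n. a n > 0" "\<And>n. d n \<ge> 1" "\<And>n. a n \<le> 2 * d n"
    and "filterlim d at_top sequentially"
  shows "(\<lambda>n. hsum (a n) (d n)) \<longlonglongrightarrow> 1"
proof (rule tendsto_sandwich[where f = "\<lambda>_. 1"])
  have "(\<lambda>n. 1 + (1/4) * inverse (d n)) \<longlonglongrightarrow> 1 + (1/4) * 0"
    by (intro tendsto_intros tendsto_inverse_0_at_top assms(4))
  then show "(\<lambda>n. 1 + 1 / (4 * d n)) \<longlonglongrightarrow> 1"
    by (simp add: field_simps)
qed (use hsum_ge_1 hsum_le assms in auto)

section \<open>The three-step recurrence of F(N)\<close>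

lemma pochhammer_shift:
  fixes a :: "'a :: comm_semiring_1"
  shows "pochhammer (a + of_nat n) k * pochhammer a n = pochhammer a k * pochhammer (a + of_nat k) n"
  by (metis pochhammer_product' add.commute mult.commute)

text \<open>From (a + i)_k = (a)_k (a + k)_i / (a)_i: an integer shift of the parameters changes
  each term by a rational function of k, so contiguous sums can be compared term by term.\<close>

lemma hterm_shift:
  assumes "a > 0" "d > 0"
  shows "hterm (a + real i) (d + real j) k =
    hterm a d k * (pochhammer (a + k) i / pochhammer a i) * (pochhammer d j / pochhammer (d + k) j) ^ 2"
proof -
  have pos: "pochhammer a i > 0" "pochhammer d j > 0" "pochhammer d k > 0"
      "pochhammer (d + k) j > 0" "pochhammer (d + j) k > 0"
    using assms by (auto intro!: pochhammer_pos)
  have 1: "pochhammer (a + i) k = pochhammer a k * pochhammer (a + k) i / pochhammer a i"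
    using pochhammer_shift[of a i k] pos by (simp add: field_simps)
  have 2: "pochhammer (d + j) k = pochhammer d k * pochhammer (d + k) j / pochhammer d j"
    using pochhammer_shift[of d j k] pos by (simp add: field_simps)
  show ?thesis
    unfolding hterm_def 1 2 using pos by (simp add: field_simps)
qed

lemma suminf_eq_of_telescoping:
  fixes f g G :: "nat \<Rightarrow> real"
  assumes "summable f" "summable g" "\<And>k. f k - g k = G (Suc k) - G k" "G 0 = 0" "G \<longlonglongrightarrow> 0"
  shows "(\<Sum>k. f k) = (\<Sum>k. g k)"
proof -
  have "(\<lambda>k. G (Suc k) - G k) sums (0 - G 0)"
    by (rule telescope_sums) fact
  then have "(\<lambda>k. f k - g k) sums 0"
    using assms by simp
  then show ?thesis
    using suminf_diff[OF assms(1,2)] sums_unique by fastforce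
qed

text \<open>The factor rho of the overview, taken at real x in place of N.\<close>

definition hsum_step :: "real \<Rightarrow> real" where
  "hsum_step x = 16 * (pochhammer (1 + x) 3) ^ 2 /
     ((3/2 + 2*x) * (5/2 + 2*x) * (9/2 + 2*x) * (11/2 + 2*x) * (5/2 + x) ^ 2)"

text \<open>Gosper's algorithm finds this polynomial, which certifies the three-step recurrence of F(N).\<close>

definition certF :: "real \<Rightarrow> real \<Rightarrow> real" where
  "certF x k = (48*x^5 + 288*x^4 + 1249/2*x^3 + 4597/8*x^2 + 739/4*x - 55/32)
     + (108*x^4 + 498*x^3 + 3023/4*x^2 + 1565/4*x + 387/16) * k
     + (82*x^3 + 535/2*x^2 + 232*x + 219/8) * k^2
     + (21*x^2 + 41*x + 29/4) * k^3"

text \<open>What remains of the telescoping in \<open>hsum_shift\<close> once the common factor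
  \<open>\<kappa> * t k / D k ^ 2\<close> is divided out: the left side is G(k+1) - G(k), the right
  side is the difference of the summands of F(x+3) and rho(x) F(x).\<close>

lemma certF_eq:
  "(1/2 + 2*x + k) * (1/2 + k)^2 * certF x (k + 1) - 4*k*(3 + x + k)^2 * certF x k =
   (5/2 + x)^2 * ((1/2 + 2*x + k) * (3/2 + 2*x + k) * (5/2 + 2*x + k) * (7/2 + 2*x + k)
     * (9/2 + 2*x + k) * (11/2 + 2*x + k))
   - 16 * (1/2 + 2*x) * (7/2 + 2*x) * ((1 + x + k) * (2 + x + k) * (3 + x + k))^2"
  unfolding certF_def by algebra

lemma tendsto_summable_mult_bounded_zero:
  fixes f g :: "nat \<Rightarrow> real"
  assumes "summable f" "\<And>k. \<bar>g k\<bar> \<le> B"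
  shows "(\<lambda>k. f k * g k) \<longlonglongrightarrow> 0"
proof (rule Lim_null_comparison)
  show "\<forall>\<^sub>F k in sequentially. norm (f k * g k) \<le> \<bar>f k\<bar> * B"
    using assms(2) by (auto simp: abs_mult intro!: always_eventually mult_left_mono)
  show "(\<lambda>k. \<bar>f k\<bar> * B) \<longlonglongrightarrow> 0"
    using summable_LIMSEQ_zero[OF assms(1)] by (intro tendsto_mult_left_zero tendsto_rabs_zero)
qed

text \<open>Used with the cubic \<open>certF x k\<close> and with M the quartic denominator of the
  telescoped sequence, which bounds their quotient uniformly in k.\<close>

lemma abs_mult_cubic_le:
  fixes k M :: real
  assumes "k \<ge> 0" "k \<le> M" "k^2 \<le> M" "k^3 \<le> M" "k^4 \<le> M"
  shows "\<bar>k * (c0 + c1 * k + c2 * k^2 + c3 * k^3)\<bar> \<le> (\<bar>c0\<bar> + \<bar>c1\<bar> + \<bar>c2\<bar> + \<bar>c3\<bar>) * M"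
proof -
  have tri: "\<bar>a + b + c + d\<bar> \<le> \<bar>a\<bar> + \<bar>b\<bar> + \<bar>c\<bar> + \<bar>d\<bar>" for a b c d :: real
    by linarith
  have "k * (c0 + c1 * k + c2 * k^2 + c3 * k^3) = c0 * k + c1 * k^2 + c2 * k^3 + c3 * k^4"
    by algebra
  also have "\<bar>\<dots>\<bar> \<le> \<bar>c0 * k\<bar> + \<bar>c1 * k^2\<bar> + \<bar>c2 * k^3\<bar> + \<bar>c3 * k^4\<bar>"
    by (rule tri)
  also have "\<dots> = \<bar>c0\<bar> * k + \<bar>c1\<bar> * k^2 + \<bar>c2\<bar> * k^3 + \<bar>c3\<bar> * k^4"
    using assms(1) by (simp add: abs_mult)
  also have "\<dots> \<le> \<bar>c0\<bar> * M + \<bar>c1\<bar> * M + \<bar>c2\<bar> * M + \<bar>c3\<bar> * M"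
    by (intro add_mono mult_left_mono assms) auto
  finally show ?thesis
    by (simp add: distrib_right)
qed

lemma hsum_shift:
  assumes x: "x \<ge> 0"
  shows "hsum (1/2 + 2 * (x + 3)) (1 + (x + 3)) = hsum_step x * hsum (1/2 + 2 * x) (1 + x)"
proof -
  define t where "t = hterm (1/2 + 2 * x) (1 + x)"
  define P where "P k = (1/2 + 2*x + k) * (3/2 + 2*x + k) * (5/2 + 2*x + k) * (7/2 + 2*x + k)
     * (9/2 + 2*x + k) * (11/2 + 2*x + k)" for k :: real
  define D where "D k = (1 + x + k) * (2 + x + k) * (3 + x + k)" for k :: real
  \<comment> \<open>\<open>\<kappa>\<close> collects the factors free of k that are shared by the
    shifted term and by \<open>hsum_step x\<close>.\<close>
  define \<kappa> where "\<kappa> = D 0 ^ 2 / (P 0 * (5/2 + x) ^ 2)"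
  \<comment> \<open>\<open>G k\<close> is a rational function of k times the term
    \<open>t k\<close>; its factor k makes \<open>G 0\<close> vanish.\<close>
  define G where "G k = t k * (\<kappa> * (4 * real k * certF x k / ((1 + x + k) * (2 + x + k)) ^ 2))" for k :: nat
  have P0: "P 0 > 0" unfolding P_def using x by (intro mult_pos_pos) auto
  have Dk: "D (real k) > 0" for k unfolding D_def using x by (intro mult_pos_pos) auto
  have poch6: "pochhammer (1/2 + 2*x + real k) 6 = P k" for k
    unfolding P_def by (simp add: eval_nat_numeral pochhammer_Suc algebra_simps)
  have poch3: "pochhammer (1 + x + real k) 3 = D k" for k
    unfolding D_def by (simp add: eval_nat_numeral pochhammer_Suc algebra_simps)
  have shift: "hterm (1/2 + 2 * (x + 3)) (1 + (x + 3)) k = t k * (P k / P 0) * (D 0 / D k) ^ 2" for k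
    using hterm_shift[of "1/2 + 2*x" "1 + x" 6 3 k] x poch6[of k] poch3[of k] poch6[of 0] poch3[of 0]
    by (simp add: t_def algebra_simps)
  have step: "hsum_step x = \<kappa> * (16 * (1/2 + 2*x) * (7/2 + 2*x))"
  proof -
    let ?R = "(3/2 + 2*x) * (5/2 + 2*x) * (9/2 + 2*x) * (11/2 + 2*x) * (5/2 + x) ^ 2"
    have *: "16 * d / R = d / (A * B * R) * (16 * A * B)" if "A \<noteq> 0" "B \<noteq> 0" for d R A B :: real
      using that by simp
    have "P 0 * (5/2 + x) ^ 2 = (1/2 + 2*x) * (7/2 + 2*x) * ?R"
      unfolding P_def add_0_right by algebra
    moreover have "pochhammer (1 + x) 3 = D 0"
      using poch3[of 0] by simp
    ultimately show ?thesis
      unfolding hsum_step_def \<kappa>_def using x by (simp only:) (rule *; simp)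
  qed
  have summ: "summable t"
    unfolding t_def using x by (intro summable_hterm) auto
  have summ': "summable (hterm (1/2 + 2 * (x + 3)) (1 + (x + 3)))"
    using x by (intro summable_hterm) auto
  have "(\<Sum>k. hterm (1/2 + 2 * (x + 3)) (1 + (x + 3)) k) = (\<Sum>k. hsum_step x * t k)"
  proof (rule suminf_eq_of_telescoping)
    show "G 0 = 0" by (simp add: G_def)
    let ?c0 = "48*x^5 + 288*x^4 + 1249/2*x^3 + 4597/8*x^2 + 739/4*x - 55/32"
    let ?c1 = "108*x^4 + 498*x^3 + 3023/4*x^2 + 1565/4*x + 387/16"
    let ?c2 = "82*x^3 + 535/2*x^2 + 232*x + 219/8"
    let ?c3 = "21*x^2 + 41*x + 29/4"
    \<comment> \<open>The multiplier of \<open>t k\<close> in \<open>G k\<close> is bounded, as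
      numerator and denominator both have degree four in k. Since \<open>t\<close> is summable,
      \<open>G\<close> tends to 0.\<close>
    have "\<bar>\<kappa> * (4 * real k * certF x k / ((1 + x + k) * (2 + x + k)) ^ 2)\<bar>
        \<le> \<bar>\<kappa>\<bar> * (4 * (\<bar>?c0\<bar> + \<bar>?c1\<bar> + \<bar>?c2\<bar> + \<bar>?c3\<bar>))" for k :: nat
    proof -
      define M where "M = ((1 + x + k) * (2 + x + k)) ^ 2"
      have "real k ^ i \<le> M" if "i \<le> 4" for i
      proof -
        have "real k ^ i \<le> (1 + x + k) ^ i" using x by (intro power_mono) auto
        also have "\<dots> \<le> (1 + x + k) ^ 4" using x that by (intro power_increasing) auto
        also have "\<dots> = ((1 + x + k) * (1 + x + k)) ^ 2" by (simp flip: power_add power_mult_distrib power2_eq_square power_mult)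
        also have "\<dots> \<le> M" unfolding M_def using x by (intro power_mono mult_left_mono) auto
        finally show ?thesis .
      qed
      from this[of 0] this[of 1] this[of 2] this[of 3] this[of 4]
      have M: "M \<ge> 1" "real k \<le> M" "real k ^ 2 \<le> M" "real k ^ 3 \<le> M" "real k ^ 4 \<le> M" by auto
      have "\<bar>k * certF x k\<bar> \<le> (\<bar>?c0\<bar> + \<bar>?c1\<bar> + \<bar>?c2\<bar> + \<bar>?c3\<bar>) * M"
        unfolding certF_def using M(2-) by (intro abs_mult_cubic_le) auto
      then have "\<bar>k * certF x k / M\<bar> \<le> \<bar>?c0\<bar> + \<bar>?c1\<bar> + \<bar>?c2\<bar> + \<bar>?c3\<bar>"
        using M(1) by (simp add: abs_divide pos_divide_le_eq)
      then have "\<bar>\<kappa>\<bar> * (4 * \<bar>k * certF x k / M\<bar>) \<le> \<bar>\<kappa>\<bar> * (4 * (\<bar>?c0\<bar> + \<bar>?c1\<bar> + \<bar>?c2\<bar> + \<bar>?c3\<bar>))"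
        by (intro mult_left_mono) auto
      then show ?thesis
        unfolding M_def[symmetric] by (simp add: abs_mult abs_divide mult_ac)
    qed
    then show "G \<longlonglongrightarrow> 0"
      unfolding G_def[abs_def] by (rule tendsto_summable_mult_bounded_zero[OF summ])
  next
    fix k :: nat
    define h where "h = \<kappa> * t k / D k ^ 2"
    have nz: "1 + x + k \<noteq> 0" "2 + x + k \<noteq> 0" "3 + x + k \<noteq> 0" "D k \<noteq> 0" "P 0 \<noteq> 0" "5/2 + x \<noteq> 0"
      using x P0 Dk[of k] by auto
    have "c * s / (A * B * C) ^ 2 * (4 * j * C ^ 2 * y) = s * (c * (4 * j * y / (A * B) ^ 2))"
      if "A \<noteq> 0" "B \<noteq> 0" "C \<noteq> 0" for A B C c s j y :: real
      using that by (simp add: field_simps)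
    from this[OF nz(1-3)] have G0: "h * (4 * real k * (3 + x + k) ^ 2 * certF x k) = G k"
      unfolding h_def G_def D_def .
    have G1: "h * ((1/2 + 2*x + k) * (1/2 + k)^2 * certF x (real k + 1)) = G (Suc k)"
    proof -
      have "c * s / (A * B * C) ^ 2 * (u * y) = s * (u / (4 * j * A ^ 2)) * (c * (4 * j * y / (B * C) ^ 2))"
        if "A \<noteq> 0" "B \<noteq> 0" "C \<noteq> 0" "j \<noteq> 0" for A B C c s j u y :: real
        using that by (simp add: field_simps)
      note * = this[OF nz(1-3), of "real k + 1"]
      have Suc: "real (Suc k) = real k + 1" "1 + x + (real k + 1) = 2 + x + real k"
          "2 + x + (real k + 1) = 3 + x + real k"
        by auto
      have "t (Suc k) = t k * ((1/2 + 2*x + k) * (1/2 + k) ^ 2 / (4 * (real k + 1) * (1 + x + k) ^ 2))"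
        unfolding t_def hterm_Suc by simp
      then show ?thesis
        unfolding h_def G_def D_def Suc by (simp only:) (rule *, simp)
    qed
    have diff: "hterm (1/2 + 2 * (x + 3)) (1 + (x + 3)) k - hsum_step x * t k =
       h * ((5/2 + x)^2 * P k - 16 * (1/2 + 2*x) * (7/2 + 2*x) * D k ^ 2)"
      unfolding shift step h_def \<kappa>_def using nz(4-6) by (simp add: field_simps)
    have c: "(5/2 + x)^2 * P k - 16 * (1/2 + 2*x) * (7/2 + 2*x) * D k ^ 2 =
        (1/2 + 2*x + k) * (1/2 + k)^2 * certF x (real k + 1) - 4 * real k * (3 + x + k)^2 * certF x k"
      unfolding certF_eq P_def D_def by (simp only: mult.assoc)
    show "hterm (1/2 + 2 * (x + 3)) (1 + (x + 3)) k - hsum_step x * t k = G (Suc k) - G k"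
      unfolding diff c right_diff_distrib G0 G1 ..
  qed (use summ summ' in \<open>auto intro: summable_mult\<close>)
  also have "\<dots> = hsum_step x * (\<Sum>k. t k)"
    by (rule suminf_mult) fact
  finally show ?thesis
    unfolding hsum_def t_def .
qed

section \<open>Limits of products as quotients of Gamma values\<close>

lemma tendsto_pochhammer_over_powr:
  fixes z :: real
  assumes "z > 0"
  shows "(\<lambda>n. pochhammer z n / (fact n * real n powr (z - 1))) \<longlonglongrightarrow> 1 / Gamma z"
proof (rule Lim_transform_eventually)
  have "Gamma z > 0" using assms by (rule Gamma_real_pos)
  then show "(\<lambda>n. inverse (Gamma_series' z n)) \<longlonglongrightarrow> 1 / Gamma z"
    unfolding inverse_eq_divide[of "Gamma z", symmetric]
    by (intro tendsto_inverse Gamma_series'_LIMSEQ) auto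
  show "\<forall>\<^sub>F n in sequentially.
      inverse (Gamma_series' z n) = pochhammer z n / (fact n * real n powr (z - 1))"
    using eventually_gt_at_top[of 0]
    by eventually_elim
       (simp add: Gamma_series'_def fact_reduce powr_def left_diff_distrib exp_diff field_simps)
qed

lemma tendsto_prod_pochhammer_over_powr:
  fixes zs :: "real list"
  assumes "\<forall>z\<in>set zs. z > 0"
  shows "(\<lambda>n. (\<Prod>j<n. \<Prod>z\<leftarrow>zs. z + real j) /
      (fact n ^ length zs * real n powr (sum_list zs - length zs))) \<longlonglongrightarrow> 1 / (\<Prod>z\<leftarrow>zs. Gamma z)"
  using assms
proof (induction zs)
  case Nil
  show ?case
    by (rule Lim_transform_eventually[OF tendsto_const eventually_mono[OF eventually_gt_at_top[of 0]]]) simp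
next
  case (Cons z zs)
  have "(\<lambda>n. (pochhammer z n / (fact n * real n powr (z - 1))) * ((\<Prod>j<n. \<Prod>z\<leftarrow>zs. z + real j) /
      (fact n ^ length zs * real n powr (sum_list zs - length zs)))) \<longlonglongrightarrow>
      1 / Gamma z * (1 / (\<Prod>z\<leftarrow>zs. Gamma z))"
    using Cons by (intro tendsto_mult tendsto_pochhammer_over_powr) auto
  moreover have "real n powr (z - 1) * real n powr (sum_list zs - length zs) =
      real n powr (sum_list (z # zs) - length (z # zs))" for n
    by (simp add: algebra_simps flip: powr_add)
  ultimately show ?case
    by (simp add: prod.distrib pochhammer_prod atLeast0LessThan mult_ac)
qed

text \<open>Equal lengths cancel the powers of n!, and equal sums cancel the remaining powers of
  n.\<close>

lemma tendsto_prod_quotient_Gamma: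
  fixes zs ws :: "real list"
  assumes "length zs = length ws" "sum_list zs = sum_list ws"
    and "\<forall>z\<in>set zs. z > 0" "\<forall>w\<in>set ws. w > 0"
  shows "(\<lambda>n. \<Prod>j<n. (\<Prod>z\<leftarrow>zs. z + real j) / (\<Prod>w\<leftarrow>ws. w + real j)) \<longlonglongrightarrow>
    (\<Prod>w\<leftarrow>ws. Gamma w) / (\<Prod>z\<leftarrow>zs. Gamma z)"
proof -
  define q where "q us n = (\<Prod>j<n. \<Prod>u\<leftarrow>us. u + real j) /
      (fact n ^ length us * real n powr (sum_list us - length us))" for us n
  have q: "q us \<longlonglongrightarrow> 1 / (\<Prod>u\<leftarrow>us. Gamma u)" if "\<forall>u\<in>set us. u > 0" for us
    unfolding q_def[abs_def] using that by (rule tendsto_prod_pochhammer_over_powr)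
  have "(\<Prod>w\<leftarrow>ws. Gamma w) \<noteq> 0"
    using assms(4) by (induction ws) (auto dest: Gamma_real_pos)
  then have "(\<lambda>n. q zs n / q ws n) \<longlonglongrightarrow> (\<Prod>w\<leftarrow>ws. Gamma w) / (\<Prod>z\<leftarrow>zs. Gamma z)"
    using tendsto_divide[OF q[OF assms(3)] q[OF assms(4)]] by simp
  moreover have "\<forall>\<^sub>F n in sequentially. q zs n / q ws n =
      (\<Prod>j<n. (\<Prod>z\<leftarrow>zs. z + real j) / (\<Prod>w\<leftarrow>ws. w + real j))"
    using eventually_gt_at_top[of 0]
    by eventually_elim (simp add: q_def assms(1,2) prod_dividef)
  ultimately show ?thesis
    by (rule Lim_transform_eventually)
qed

lemma hsum_iterate:
  assumes "x \<ge> 0"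
  shows "hsum (1/2 + 2 * (x + 3 * real n)) (1 + (x + 3 * real n)) =
    hsum (1/2 + 2 * x) (1 + x) * (\<Prod>j<n. hsum_step (x + 3 * real j))"
proof (induction n)
  case (Suc n)
  then show ?case
    using hsum_shift[of "x + 3 * real n"] assms by (simp add: algebra_simps)
qed simp

text \<open>Iterating the recurrence sends the parameters to infinity, where the sum tends to 1;
  hence the initial sum is the reciprocal of the product of all steps.\<close>

lemma hsum_mult_limit:
  assumes "x \<ge> 0" "(\<lambda>n. \<Prod>j<n. hsum_step (x + 3 * real j)) \<longlonglongrightarrow> R"
  shows "hsum (1/2 + 2 * x) (1 + x) * R = 1"
proof (rule LIMSEQ_unique)
  show "(\<lambda>n. hsum (1/2 + 2 * (x + 3 * real n)) (1 + (x + 3 * real n)))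
      \<longlonglongrightarrow> hsum (1/2 + 2 * x) (1 + x) * R"
    unfolding hsum_iterate[OF assms(1)] by (intro tendsto_intros assms)
  show "(\<lambda>n. hsum (1/2 + 2 * (x + 3 * real n)) (1 + (x + 3 * real n))) \<longlonglongrightarrow> 1"
    using assms(1) by (intro tendsto_hsum_1) (auto, real_asymp)
qed

text \<open>The chain N = 0, 3, 6, ... At x = 3 j each linear factor of \<open>hsum_step\<close> is
  3 or 6 times some z + j, which yields the two lists; the constants cancel because 16 * 27^2 = 6^4
  * 3^2.\<close>

lemma hsum_half_one:
  "hsum (1/2) 1 * (Gamma (1/4) * Gamma (3/4) * Gamma (5/12) * Gamma (11/12) * Gamma (5/6) ^ 2) =
     (Gamma (1/3) * Gamma (2/3)) ^ 2"
proof -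
  let ?zs = "[1/3, 1/3, 2/3, 2/3, 1, 1] :: real list"
  let ?ws = "[1/4, 3/4, 5/12, 11/12, 5/6, 5/6] :: real list"
  have "hsum_step (0 + 3 * real j) = (\<Prod>z\<leftarrow>?zs. z + real j) / (\<Prod>w\<leftarrow>?ws. w + real j)" for j
  proof -
    define x where "x = real j"
    have num: "pochhammer (1 + (0 + 3 * x)) 3 = 27 * ((1/3 + x) * (2/3 + x) * (1 + x))"
      by (simp add: eval_nat_numeral pochhammer_Suc) algebra
    have den: "(3/2 + 2 * (0 + 3 * x)) * (5/2 + 2 * (0 + 3 * x)) * (9/2 + 2 * (0 + 3 * x))
        * (11/2 + 2 * (0 + 3 * x)) * (5/2 + (0 + 3 * x)) ^ 2 = 16 * 729 * ((1/4 + x) * (3/4 + x) * (5/12 + x) * (11/12 + x) * (5/6 + x) ^ 2)"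
      by algebra
    have cancel: "16 * (27 * a) ^ 2 / (16 * 729 * b) = a ^ 2 / b" for a b :: real
      by (simp add: power2_eq_square)
    show ?thesis
      unfolding hsum_step_def x_def[symmetric] num den cancel by (simp add: power2_eq_square mult_ac)
  qed
  then have "(\<lambda>n. \<Prod>j<n. hsum_step (0 + 3 * real j)) \<longlonglongrightarrow> (\<Prod>w\<leftarrow>?ws. Gamma w) / (\<Prod>z\<leftarrow>?zs. Gamma z)"
    using tendsto_prod_quotient_Gamma[of ?zs ?ws] by (simp only: ) simp
  from hsum_mult_limit[OF _ this] show ?thesis
    by (auto simp: power2_eq_square mult_ac)
qed

text \<open>The chain N = 1, 4, 7, ..., treated in the same way; this sum enters through
  \<open>minsol 0 - minsol 1\<close>.\<close>

lemma hsum_five_halves_two: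
  "hsum (5/2) 2 * (Gamma (3/4) * Gamma (5/4) * Gamma (7/12) * Gamma (13/12) * Gamma (7/6) ^ 2) =
     (Gamma (2/3) * Gamma (4/3)) ^ 2"
proof -
  let ?zs = "[2/3, 2/3, 1, 1, 4/3, 4/3] :: real list"
  let ?ws = "[3/4, 5/4, 7/12, 13/12, 7/6, 7/6] :: real list"
  have "hsum_step (1 + 3 * real j) = (\<Prod>z\<leftarrow>?zs. z + real j) / (\<Prod>w\<leftarrow>?ws. w + real j)" for j
  proof -
    define x where "x = real j"
    have num: "pochhammer (1 + (1 + 3 * x)) 3 = 27 * ((2/3 + x) * (1 + x) * (4/3 + x))"
      by (simp add: eval_nat_numeral pochhammer_Suc) algebra
    have den: "(3/2 + 2 * (1 + 3 * x)) * (5/2 + 2 * (1 + 3 * x)) * (9/2 + 2 * (1 + 3 * x))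
        * (11/2 + 2 * (1 + 3 * x)) * (5/2 + (1 + 3 * x)) ^ 2 = 16 * 729 * ((3/4 + x) * (5/4 + x) * (7/12 + x) * (13/12 + x) * (7/6 + x) ^ 2)"
      by algebra
    have cancel: "16 * (27 * a) ^ 2 / (16 * 729 * b) = a ^ 2 / b" for a b :: real
      by (simp add: power2_eq_square)
    show ?thesis
      unfolding hsum_step_def x_def[symmetric] num den cancel by (simp add: power2_eq_square mult_ac)
  qed
  then have "(\<lambda>n. \<Prod>j<n. hsum_step (1 + 3 * real j)) \<longlonglongrightarrow> (\<Prod>w\<leftarrow>?ws. Gamma w) / (\<Prod>z\<leftarrow>?zs. Gamma z)"
    using tendsto_prod_quotient_Gamma[of ?zs ?ws] by (simp only: ) simp
  from hsum_mult_limit[OF _ this] show ?thesis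
    by (auto simp: power2_eq_square mult_ac)
qed


section \<open>Product and quotient of F(0) and F(1)\<close>

lemma Gamma_reflection_real:
  fixes x :: real
  shows "Gamma x * Gamma (1 - x) = pi / sin (pi * x)"
proof -
  have "complex_of_real (Gamma x * Gamma (1 - x)) = Gamma (of_real x) * Gamma (1 - of_real x)"
    using Gamma_complex_of_real[of "1 - x"] by (simp add: Gamma_complex_of_real)
  also have "\<dots> = of_real (pi / sin (pi * x))"
    unfolding Gamma_reflection_complex by (simp flip: sin_of_real)
  finally show ?thesis
    by (simp only: of_real_eq_iff)
qed

lemma Gamma_legendre_duplication_real:
  fixes x :: real
  assumes "x > 0"
  shows "Gamma x * Gamma (x + 1/2) = 2 powr (1 - 2 * x) * sqrt pi * Gamma (2 * x)"
proof -
  have nonpos: "complex_of_real y \<notin> \<int>\<^sub>\<le>\<^sub>0" if "y > 0" for y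
    using that by (auto simp: of_real_in_nonpos_Ints_iff elim!: nonpos_Ints_cases)
  have "complex_of_real (Gamma x * Gamma (x + 1/2)) = Gamma (of_real x) * Gamma (of_real x + 1/2)"
    using Gamma_complex_of_real[of "x + 1/2"] by (simp add: Gamma_complex_of_real)
  also have "\<dots> = exp ((1 - 2 * of_real x) * of_real (ln 2)) * of_real (sqrt pi) * Gamma (2 * of_real x)"
    using nonpos[of x] nonpos[of "x + 1/2"] assms by (intro Gamma_legendre_duplication) auto
  also have "\<dots> = of_real (2 powr (1 - 2 * x) * sqrt pi * Gamma (2 * x))"
    using Gamma_complex_of_real[of "2 * x"] exp_of_real[of "(1 - 2 * x) * ln 2", where 'a = complex]
    by (simp add: powr_def)
  finally show ?thesis
    by (simp only: of_real_eq_iff)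
qed

text \<open>Duplication removes the Gamma values at quarters and twelfths, leaving F(0) proportional
  to Gamma(5/6)^(-3) and F(1) to Gamma(7/6)^(-3). Reflection evaluates the product of these two
  Gamma values, duplication their quotient.\<close>

lemma hsum_evaluation:
  fixes F0 F1 L :: real
  defines "F0 \<equiv> hsum (1/2) 1" and "F1 \<equiv> hsum (5/2) 2"
    and "L \<equiv> 2 powr (-1/3) * (Gamma (1/3) / Gamma (2/3)) ^ 6"
  shows "F0 * F1 = 32 / (3 * pi\<^sup>2)" and "L * F1 = 48 * F0"
proof -
  \<comment> \<open>All powers of 2 that occur below, in the duplications and in \<open>L\<close>,
    have exponents that are multiples of 1/6; with \<open>c\<close> they become integer
    powers.\<close>
  define A B u v s c where "A = Gamma (1/3::real)" and "B = Gamma (2/3::real)"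
    and "u = Gamma (5/6::real)" and "v = Gamma (7/6::real)" and "s = sqrt pi" and "c = 2 powr (1/6::real)"
  have pos: "A > 0" "B > 0" "u > 0" "v > 0" "s > 0" "c > 0"
    unfolding A_def B_def u_def v_def s_def c_def by (auto intro!: Gamma_real_pos)
  have s2: "s ^ 2 = pi" by (simp add: s_def)
  have c_pow: "2 powr (1/2::real) = c ^ 3" "2 powr (1/6::real) = c" "2 powr (1/3::real) = c ^ 2" "2 powr (2/3::real) = c ^ 4"
    "2 powr (-(1/2)::real) = 1 / c ^ 3" "2 powr (-(1/6)::real) = 1 / c" "2 powr (-(1/3)::real) = 1 / c ^ 2"
    unfolding c_def by (simp_all add: powr_power powr_minus_divide)
  have rec: "Gamma (x + 1) = x * Gamma x" if "x > 0" for x :: real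
    using that by (intro Gamma_plus1) (auto elim!: nonpos_Ints_cases)
  have half: "Gamma (1/2::real) = s" "Gamma (3/2::real) = s / 2"
    using rec[of "1/2::real"] by (auto simp: s_def Gamma_one_half_real)
  have G43: "Gamma (4/3::real) = A / 3"
    using rec[of "1/3::real"] by (auto simp: A_def)
  have G76: "Gamma (1/6::real) = 6 * v"
    using rec[of "1/6::real"] by (auto simp: v_def)
  have dup: "Gamma (1/4::real) * Gamma (3/4) = c ^ 3 * s ^ 2"
    "Gamma (5/12::real) * Gamma (11/12) = c * s * u"
    "Gamma (3/4::real) * Gamma (5/4) = s ^ 2 / (2 * c ^ 3)"
    "Gamma (7/12::real) * Gamma (13/12) = s * v / c"
    "A * u = c ^ 2 * s * B"
    "6 * v * B = c ^ 4 * s * A"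
    using Gamma_legendre_duplication_real[of "1/4"] Gamma_legendre_duplication_real[of "5/12"]
      Gamma_legendre_duplication_real[of "3/4"] Gamma_legendre_duplication_real[of "7/12"]
      Gamma_legendre_duplication_real[of "1/3"] Gamma_legendre_duplication_real[of "1/6"]
    by (simp_all add: c_pow half G76 power2_eq_square flip: A_def B_def u_def v_def s_def)
  have AB: "(A * B) ^ 2 = 4 * pi ^ 2 / 3"
  proof -
    have "A * B = pi / (sqrt 3 / 2)"
      using Gamma_reflection_real[of "1/3"] by (simp add: A_def B_def sin_60)
    then show ?thesis by (simp add: power_divide power_mult_distrib)
  qed
  have uv: "u * v = pi / 3"
    using Gamma_reflection_real[of "1/6"] by (simp add: G76 sin_30 flip: u_def)
  have F0: "F0 * (c ^ 4 * s ^ 3 * u ^ 3) = (A * B) ^ 2"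
    using hsum_half_one dup(1,2) unfolding F0_def A_def[symmetric] B_def[symmetric] u_def[symmetric]
    by (simp add: mult.assoc) (simp add: mult_ac power2_eq_square power3_eq_cube power4_eq_xxxx)
  have F1: "F1 * (s ^ 3 * v ^ 3) = 2 * c ^ 4 * (A * B) ^ 2 / 9"
  proof -
    have "F1 * ((Gamma (3/4) * Gamma (5/4)) * (Gamma (7/12) * Gamma (13/12)) * v ^ 2) = (B * (A / 3)) ^ 2"
      using hsum_five_halves_two unfolding F1_def G43 B_def[symmetric] v_def[symmetric] by (simp add: mult_ac)
    then have "F1 * (s ^ 3 * v ^ 3 / (2 * c ^ 4)) = (A * B) ^ 2 / 9"
      unfolding dup using pos by (simp add: field_simps eval_nat_numeral)
    then show ?thesis using pos by (simp add: field_simps)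
  qed
  have "(F0 * F1) * (c ^ 4 * s ^ 6 * (u * v) ^ 3) = (F0 * (c ^ 4 * s ^ 3 * u ^ 3)) * (F1 * (s ^ 3 * v ^ 3))"
    by algebra
  also have "\<dots> = 2 * c ^ 4 * ((A * B) ^ 2) ^ 2 / 9"
    unfolding F0 F1 by (simp add: power2_eq_square)
  finally have "c ^ 4 * (F0 * F1 * (s ^ 6 * (u * v) ^ 3)) = c ^ 4 * (2 * ((A * B) ^ 2) ^ 2 / 9)"
    by (simp add: mult_ac)
  then have eq: "F0 * F1 * (s ^ 6 * (u * v) ^ 3) = 2 * ((A * B) ^ 2) ^ 2 / 9"
    using pos by simp
  have s6: "s ^ 6 = pi ^ 3"
    using power_mult[of s 2 3] by (simp add: s2)
  show "F0 * F1 = 32 / (3 * pi\<^sup>2)"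
    using eq unfolding AB uv s6 by (simp add: field_simps eval_nat_numeral)
  have L: "L * (c ^ 2 * B ^ 6) = A ^ 6"
    unfolding L_def A_def[symmetric] B_def[symmetric] using pos c_pow(7) by (simp add: field_simps)
  \<comment> \<open>Duplication at 1/3 and at 1/6 together give u / v in terms of A / B. Its cube,
    below, produces the sixth power in \<open>L\<close>.\<close>
  have ratio: "u * (c ^ 2 * A ^ 2) = 6 * v * B ^ 2"
  proof -
    have "(c ^ 2 * s) * (u * (c ^ 2 * A ^ 2)) = (A * u) * (c ^ 4 * s * A)" by algebra
    also have "\<dots> = (c ^ 2 * s) * (6 * v * B ^ 2)"
      unfolding dup(5) dup(6)[symmetric] by algebra
    finally show ?thesis using pos by simp
  qed
  have ratio3: "u ^ 3 * (c ^ 6 * A ^ 6) = 216 * v ^ 3 * B ^ 6"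
    using arg_cong[OF ratio, of "\<lambda>x. x ^ 3"] by (simp add: power_mult_distrib flip: power_mult)
  have "(s ^ 3 * v ^ 3 * u ^ 3 * c ^ 6 * B ^ 6) * (L * F1) =
      c ^ 4 * u ^ 3 * (L * (c ^ 2 * B ^ 6)) * (F1 * (s ^ 3 * v ^ 3))"
    by algebra
  also have "\<dots> = c ^ 2 * 2 / 9 * (u ^ 3 * (c ^ 6 * A ^ 6)) * (A * B) ^ 2"
    unfolding L F1 by algebra
  also have "\<dots> = (s ^ 3 * v ^ 3 * u ^ 3 * c ^ 6 * B ^ 6) * (48 * F0)"
    unfolding ratio3 F0[symmetric] by algebra
  finally show "L * F1 = 48 * F0"
    using pos by simp
qed


section \<open>The minimal solution of the recurrence\<close>

text \<open>A solution u of the Apery-like recurrence, read at s = n - 1/2. The squared prefactor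
  turns the contiguous relation between the sums into that recurrence, and \<open>minsol 0\<close>
  is F(0).\<close>

definition minsol :: "nat \<Rightarrow> real" where
  "minsol n = (pochhammer (1/2) n / fact n) ^ 2 * hsum (1/2) (1 + real n)"

lemma minsol_pos: "minsol n > 0"
proof -
  have "hsum (1/2) (1 + real n) \<ge> 1"
    by (intro hsum_ge_1) auto
  then show ?thesis
    unfolding minsol_def by (intro mult_pos_pos zero_less_power divide_pos_pos pochhammer_pos) auto
qed

text \<open>Since Gamma(1/2)^2 = pi, the squared prefactor behaves like 1 / (pi n), while the
  hypergeometric sum tends to 1.\<close>

lemma tendsto_minsol: "(\<lambda>n. real n * minsol n) \<longlonglongrightarrow> 1 / pi"
proof (rule Lim_transform_eventually)
  have "(\<lambda>n. hsum (1/2) (1 + real n)) \<longlonglongrightarrow> 1"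
    by (intro tendsto_hsum_1) (auto, real_asymp)
  then have "(\<lambda>n. (pochhammer (1/2) n / (fact n * real n powr (1/2 - 1))) ^ 2 * hsum (1/2) (1 + real n))
      \<longlonglongrightarrow> (1 / Gamma (1/2)) ^ 2 * 1"
    by (intro tendsto_intros tendsto_pochhammer_over_powr) auto
  then show "(\<lambda>n. (pochhammer (1/2) n / (fact n * real n powr (1/2 - 1))) ^ 2 * hsum (1/2) (1 + real n))
      \<longlonglongrightarrow> 1 / pi"
    by (simp add: Gamma_one_half_real power_divide)
  have powr_sq: "(real n powr (1/2 - 1)) ^ 2 = 1 / real n" if "n > 0" for n
    using that by (simp add: powr_minus_divide powr_half_sqrt power_divide)
  show "\<forall>\<^sub>F n in sequentially. (pochhammer (1/2) n / (fact n * real n powr (1/2 - 1))) ^ 2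
      * hsum (1/2) (1 + real n) = real n * minsol n"
    using eventually_gt_at_top[of 0]
    by eventually_elim (simp only: minsol_def power_divide power_mult_distrib powr_sq, simp)
qed

text \<open>This is \<open>minsol_rec\<close> with the common prefactor divided out and n replaced
  by a real x. All three summands are written as rational multiples of the term with lower
  parameters 1 + x, and their combination telescopes.\<close>

lemma hsum_contiguous:
  fixes x :: real
  assumes x: "x \<ge> 0"
  shows "(2*x + 3)^2 * ((1/2 + x) * (3/2 + x) / ((1 + x) * (2 + x)))^2 * hsum (1/2) (1 + (x + 2))
     + 9 * (2*x + 1)^2 * hsum (1/2) (1 + x)
     = (40*(x+1)^2 + 2) * ((1/2 + x) / (1 + x))^2 * hsum (1/2) (1 + (x + 1))"
proof -
  define t where "t = hterm (1/2) (1 + x)"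
  define D where "D k = (1 + x + k) * (2 + x + k)" for k :: real
  \<comment> \<open>Zeilberger certificate\<close>
  define cert where "cert k = - ((2*x + 1)^2 * (4*x + 9/2 + 3*k))" for k :: real
  define G where "G k = t k * (4 * real k * cert k / (1 + x + k) ^ 2)" for k :: nat
  let ?c2 = "(2*x + 3)^2 * ((1/2 + x) * (3/2 + x) / ((1 + x) * (2 + x)))^2"
  let ?c1 = "(40*(x+1)^2 + 2) * ((1/2 + x) / (1 + x))^2"
  let ?c0 = "9 * (2*x + 1)^2"
  have summ: "summable (hterm (1/2) (1 + y))" if "y \<ge> 0" for y
    using that by (intro summable_hterm) auto
  have t1: "hterm (1/2) (1 + (x + 1)) k = t k * ((1 + x) / (1 + x + k)) ^ 2" for k
    using hterm_shift[of "1/2" "1 + x" 0 1 k] x by (simp add: t_def add_ac)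
  have t2: "hterm (1/2) (1 + (x + 2)) k = t k * ((1 + x) * (2 + x) / ((1 + x + k) * (2 + x + k))) ^ 2" for k
    using hterm_shift[of "1/2" "1 + x" 0 2 k] x
    by (simp add: t_def eval_nat_numeral pochhammer_Suc add_ac)
  have "(\<Sum>k. ?c2 * hterm (1/2) (1 + (x + 2)) k + ?c0 * t k) = (\<Sum>k. ?c1 * hterm (1/2) (1 + (x + 1)) k)"
  proof (rule suminf_eq_of_telescoping)
    show "summable (\<lambda>k. ?c2 * hterm (1/2) (1 + (x + 2)) k + ?c0 * t k)"
      unfolding t_def using x by (intro summable_add summable_mult summ) auto
    show "summable (\<lambda>k. ?c1 * hterm (1/2) (1 + (x + 1)) k)"
      using x by (intro summable_mult summ) auto
    show "G 0 = 0" by (simp add: G_def)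
    \<comment> \<open>Here k times the certificate is quadratic in k, like the denominator; 15/2 is
      9/2 + 3.\<close>
    have "\<bar>4 * real k * cert k / (1 + x + k) ^ 2\<bar> \<le> 4 * (2*x + 1)^2 * (4*x + 15/2)" for k :: nat
    proof -
      define M where "M = (1 + x + k) ^ 2"
      have M: "M > 0" "real k \<le> M" "real k * k \<le> M"
        unfolding M_def using x by (auto simp: power2_eq_square algebra_simps intro: add_pos_nonneg)
      have "real k * (4*x + 9/2 + 3*k) = (4*x + 9/2) * k + 3 * (real k * k)"
        by (simp add: algebra_simps)
      also have "\<dots> \<le> (4*x + 9/2) * M + 3 * M"
        using M x by (intro add_mono mult_left_mono) auto
      finally have "4 * (2*x + 1)^2 * (real k * (4*x + 9/2 + 3*k)) \<le> 4 * (2*x + 1)^2 * ((4*x + 15/2) * M)"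
        by (intro mult_left_mono) (simp_all add: algebra_simps)
      moreover have "\<bar>4 * real k * cert k\<bar> = 4 * (2*x + 1)^2 * (real k * (4*x + 9/2 + 3*k))"
        unfolding cert_def using x by (simp add: abs_mult)
      ultimately show ?thesis
        unfolding M_def[symmetric] using M(1) by (simp add: abs_divide pos_divide_le_eq mult.assoc)
    qed
    then show "G \<longlonglongrightarrow> 0"
      unfolding G_def[abs_def] t_def using x
      by (intro tendsto_summable_mult_bounded_zero[OF summ]) auto
  next
    fix k :: nat
    define h where "h = t k / D k ^ 2"
    have nz: "1 + x + k \<noteq> 0" "2 + x + k \<noteq> 0" "1 + x \<noteq> 0" "2 + x \<noteq> 0" using x by auto
    have "s / (A * B) ^ 2 * (4 * j * B ^ 2 * y) = s * (4 * j * y / A ^ 2)"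
      if "A \<noteq> 0" "B \<noteq> 0" for A B s j y :: real
      using that by (simp add: field_simps)
    from this[OF nz(1,2)] have G0: "h * (4 * real k * (2 + x + k) ^ 2 * cert k) = G k"
      unfolding h_def G_def D_def .
    have G1: "h * ((1/2 + real k) ^ 3 * cert (real k + 1)) = G (Suc k)"
    proof -
      have "s / (A * B) ^ 2 * (u * y) = s * (u / (4 * j * A ^ 2)) * (4 * j * y / B ^ 2)"
        if "A \<noteq> 0" "B \<noteq> 0" "j \<noteq> 0" for A B s j u y :: real
        using that by (simp add: field_simps)
      note * = this[OF nz(1,2), of "real k + 1"]
      have Suc: "real (Suc k) = real k + 1" "1 + x + (real k + 1) = 2 + x + real k"
        by auto
      have "t (Suc k) = t k * ((1/2 + real k) ^ 3 / (4 * (real k + 1) * (1 + x + k) ^ 2))"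
        unfolding t_def hterm_Suc by (simp add: power3_eq_cube power2_eq_square)
      then show ?thesis
        unfolding h_def G_def D_def Suc by (simp only:) (rule *, simp)
    qed
    let ?C = "(2*x + 3)^2 * ((1/2 + x) * (3/2 + x))^2 - (40*(x+1)^2 + 2) * (1/2 + x)^2 * (2 + x + k)^2
        + 9 * (2*x + 1)^2 * ((1 + x + k) * (2 + x + k))^2"
    have diff: "?c2 * hterm (1/2) (1 + (x + 2)) k + ?c0 * t k - ?c1 * hterm (1/2) (1 + (x + 1)) k = h * ?C"
    proof -
      have "a * (b / (d * e))^2 * (s * (d * e / (d' * e'))^2) + f * s - g * (b' / d)^2 * (s * (d / d')^2)
          = s / (d' * e')^2 * (a * b^2 - g * b'^2 * e'^2 + f * (d' * e')^2)"
        if "d \<noteq> 0" "e \<noteq> 0" "d' \<noteq> 0" "e' \<noteq> 0" for a b b' d d' e e' f g s :: real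
        using that by (simp add: field_simps)
      from this[OF nz(3,4,1,2)] show ?thesis
        unfolding t1 t2 h_def D_def .
    qed
    have c: "?C = (1/2 + real k) ^ 3 * cert (real k + 1) - 4 * real k * (2 + x + k) ^ 2 * cert k"
      unfolding cert_def by algebra
    show "?c2 * hterm (1/2) (1 + (x + 2)) k + ?c0 * t k - ?c1 * hterm (1/2) (1 + (x + 1)) k = G (Suc k) - G k"
      unfolding diff c right_diff_distrib G0 G1 ..
  qed
  moreover have "(\<Sum>k. ?c2 * hterm (1/2) (1 + (x + 2)) k + ?c0 * t k) =
      (\<Sum>k. ?c2 * hterm (1/2) (1 + (x + 2)) k) + (\<Sum>k. ?c0 * t k)"
    unfolding t_def using x by (intro suminf_add[symmetric] summable_mult summ) auto
  moreover have "(\<Sum>k. ?c2 * hterm (1/2) (1 + (x + 2)) k) = ?c2 * hsum (1/2) (1 + (x + 2))"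
    unfolding hsum_def using x by (intro suminf_mult summ) auto
  moreover have "(\<Sum>k. ?c0 * t k) = ?c0 * hsum (1/2) (1 + x)"
    unfolding hsum_def t_def using x by (intro suminf_mult summ) auto
  moreover have "(\<Sum>k. ?c1 * hterm (1/2) (1 + (x + 1)) k) = ?c1 * hsum (1/2) (1 + (x + 1))"
    unfolding hsum_def using x by (intro suminf_mult summ) auto
  ultimately show ?thesis by simp
qed

lemma minsol_rec:
  "(2 * real n + 3)^2 * minsol (n + 2) = (40 * (real n + 1)^2 + 2) * minsol (n + 1)
     - 9 * (2 * real n + 1)^2 * minsol n"
proof -
  define e where "e = (pochhammer (1/2) n / fact n :: real) ^ 2"
  have m0: "minsol n = e * hsum (1/2) (1 + real n)"
    by (simp add: minsol_def e_def)
  have m1: "minsol (n + 1) = e * ((1/2 + real n) / (1 + real n)) ^ 2 * hsum (1/2) (1 + (real n + 1))"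
    by (simp add: minsol_def e_def pochhammer_Suc power_mult_distrib power_divide add_ac)
  have m2: "minsol (n + 2) = e * ((1/2 + real n) * (3/2 + real n) / ((1 + real n) * (2 + real n))) ^ 2
      * hsum (1/2) (1 + (real n + 2))"
    by (simp add: minsol_def e_def pochhammer_Suc power_mult_distrib power_divide add_ac mult_ac)
  show ?thesis
    unfolding m0 m1 m2 using arg_cong[OF hsum_contiguous[of "real n"], of "(*) e"]
    by (simp add: algebra_simps)
qed

text \<open>The two sides agree termwise, since (k + 1)^2 - 1/4 = (k + 1/2) (k + 3/2).\<close>

lemma minsol_0_diff: "minsol 0 - minsol 1 = 3/4 * hsum (5/2) 2"
proof -
  have summ: "summable (hterm (1/2) 1)" "summable (hterm (1/2) 2)" "summable (hterm (5/2) 2)"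
    by (intro summable_hterm; simp)+
  have "hterm (1/2) 1 k - 1/4 * hterm (1/2) 2 k = 3/4 * hterm (5/2) 2 k" for k
  proof -
    have 1: "hterm (1/2) 2 k = hterm (1/2) 1 k / (1 + real k)^2"
      using hterm_shift[of "1/2" 1 0 1 k] by (simp add: power_divide)
    have 2: "hterm (5/2) 2 k = hterm (1/2) 1 k * ((1/2 + real k) * (3/2 + real k) / (3/4)) / (1 + real k)^2"
      using hterm_shift[of "1/2" 1 2 1 k] by (simp add: power_divide eval_nat_numeral pochhammer_Suc add_ac)
    have "t - 1/4 * (t / j^2) = 3/4 * (t * ((j - 1/2) * (j + 1/2) / (3/4)) / j^2)" if "j \<noteq> 0" for t j :: real
      using that by (simp add: field_simps power2_eq_square)
    from this[of "1 + real k" "hterm (1/2) 1 k"] show ?thesis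
      unfolding 1 2 by (simp add: algebra_simps)
  qed
  then have "(\<Sum>k. hterm (1/2) 1 k - 1/4 * hterm (1/2) 2 k) = (\<Sum>k. 3/4 * hterm (5/2) 2 k)"
    by (simp only:)
  then show ?thesis
    using suminf_diff[OF summ(1) summable_mult[OF summ(2), of "1/4"]]
      suminf_mult[OF summ(2), of "1/4"] suminf_mult[OF summ(3), of "3/4"]
    by (simp add: minsol_def hsum_def power2_eq_square)
qed

section \<open>Convergents\<close>

text \<open>Unrolling the recurrence trades one level of the tail for one factor, so D is a product
  of tails. It is chosen before u: the same D serves every solution and therefore cancels in p(n) /
  q(n).\<close>

lemma cf_tail_solution:
  assumes "\<And>k m. k \<ge> 2 \<Longrightarrow> cf_tail a b k m \<noteq> 0"
  shows "\<exists>D\<noteq>0. \<forall>u. (\<forall>n. u (n + 2) = a (n + 2) * u (n + 1) + b (n + 1) * u n) \<longrightarrow>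
    u (k + 2 + m) = D * (cf_tail a b (k + 2) m * u (k + 1) + b (k + 1) * u k)"
proof (induction m arbitrary: k)
  case 0
  show ?case by (intro exI[of _ 1]) simp
next
  case (Suc m)
  define t where "t = cf_tail a b (k + 3) m"
  have t: "t \<noteq> 0" unfolding t_def by (intro assms) simp
  have tail: "cf_tail a b (k + 2) (Suc m) = a (k + 2) + b (k + 2) / t"
    by (simp add: t_def eval_nat_numeral)
  from Suc[of "k + 1"] obtain D where D: "D \<noteq> 0"
    "\<And>u. \<forall>n. u (n + 2) = a (n + 2) * u (n + 1) + b (n + 1) * u n \<Longrightarrow>
       u (k + 3 + m) = D * (t * u (k + 2) + b (k + 2) * u (k + 1))"
    by (auto simp: t_def add_ac eval_nat_numeral)
  show ?case
  proof (intro exI[of _ "D * t"] conjI allI impI)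
    fix u :: "nat \<Rightarrow> real"
    assume u: "\<forall>n. u (n + 2) = a (n + 2) * u (n + 1) + b (n + 1) * u n"
    have uk: "u (k + 2) = a (k + 2) * u (k + 1) + b (k + 1) * u k"
      using u by blast
    have "u (k + 2 + Suc m) = D * (t * u (k + 2) + b (k + 2) * u (k + 1))"
      using D(2)[OF u] by (simp add: add_ac eval_nat_numeral)
    also have "\<dots> = D * t * ((a (k + 2) + b (k + 2) / t) * u (k + 1) + b (k + 1) * u k)"
      unfolding uk using t by (simp add: field_simps)
    finally show "u (k + 2 + Suc m) = D * t * (cf_tail a b (k + 2) (Suc m) * u (k + 1) + b (k + 1) * u k)"
      unfolding tail .
  qed (use D t in auto)
qed

text \<open>Nonzero tails keep every nested division away from the default value x / 0 = 0.
  Numerators and denominators are then expressed by \<open>cf_tail_solution\<close> at k = 0 with a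
  common D.\<close>

lemma cf_convergent_eq:
  assumes nz: "\<And>k m. k \<ge> 1 \<Longrightarrow> cf_tail a b k m \<noteq> 0"
    and p: "p 0 = a 0" "p 1 = a 1 * a 0 + b 0" "\<forall>n. p (n + 2) = a (n + 2) * p (n + 1) + b (n + 1) * p n"
    and q: "q 0 = 1" "q 1 = a 1" "\<forall>n. q (n + 2) = a (n + 2) * q (n + 1) + b (n + 1) * q n"
  shows "cf_convergent a b n = p n / q n" "q n \<noteq> 0"
proof -
  have "cf_convergent a b n = p n / q n \<and> q n \<noteq> 0"
  proof -
    consider "n = 0" | "n = 1" | m where "n = m + 2"
      by (metis One_nat_def add_2_eq_Suc' not0_implies_Suc)
    then show ?thesis
    proof cases
      case 1
      then show ?thesis using p q by (simp add: cf_convergent_def)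
    next
      case 2
      have "a 1 \<noteq> 0" using nz[of 1 0] by simp
      then show ?thesis using 2 p(2) q(2) by (simp add: cf_convergent_def field_simps)
    next
      case (3 m)
      define t where "t = cf_tail a b 2 m"
      have t: "t \<noteq> 0" unfolding t_def by (intro nz) simp
      have t1: "cf_tail a b 1 (Suc m) = a 1 + b 1 / t"
        by (simp add: t_def eval_nat_numeral)
      have nz1: "a 1 + b 1 / t \<noteq> 0"
        using nz[of 1 "Suc m"] unfolding t1 by simp
      have conv: "cf_convergent a b n = a 0 + b 0 / (a 1 + b 1 / t)"
        using t1 3 by (simp add: cf_convergent_def)
      have "\<And>k m. k \<ge> 2 \<Longrightarrow> cf_tail a b k m \<noteq> 0" by (rule nz) simp
      from cf_tail_solution[of a b 0 m, OF this] obtain D where D: "D \<noteq> 0"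
        "\<And>u. \<forall>n. u (n + 2) = a (n + 2) * u (n + 1) + b (n + 1) * u n \<Longrightarrow>
           u n = D * (t * u 1 + b 1 * u 0)"
        using 3 by (auto simp: t_def add_ac eval_nat_numeral)
      have pn: "p n = D * t * ((a 1 + b 1 / t) * a 0 + b 0)"
        using D(2)[OF p(3)] p(1,2) t by (simp add: field_simps)
      have qn: "q n = D * t * (a 1 + b 1 / t)"
        using D(2)[OF q(3)] q(1,2) t by (simp add: field_simps)
      have "(D * t * (s * a 0 + b 0)) / (D * t * s) = a 0 + b 0 / s" if "s \<noteq> 0" for s
        using that t D(1) by (simp add: add_divide_distrib)
      from this[OF nz1] show ?thesis
        unfolding conv pn qn using t D(1) nz1 by simp
    qed
  qed
  then show "cf_convergent a b n = p n / q n" "q n \<noteq> 0" by auto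
qed

text \<open>To leading order the tails are f k^2 with f = 40 - 144 / f, whose larger root is 36; the
  bound has this growth. It reproduces itself: the next tail being at least 9 (2k+1)^2, at most
  (2k+1)^2 is subtracted from a(k). The exceptional a(1) = 33 is checked separately.\<close>

lemma cf_tail_41_ge:
  "k \<ge> 1 \<Longrightarrow> cf_tail a41 b41 k m \<ge> 9 * (2 * real k - 1) ^ 2"
proof (induction m arbitrary: k)
  case 0
  then have "real k \<ge> 1" by simp
  moreover have "(real k)^2 \<ge> 0" by simp
  moreover have "40 * (real k)^2 + 2 - 9 * (2 * real k - 1)^2 = 4 * (real k)^2 + 36 * real k - 7"
    by (simp add: power2_eq_square algebra_simps)
  ultimately have "9 * (2 * real k - 1)^2 \<le> 40 * (real k)^2 + 2" by linarith
  with 0 show ?case by (cases "k = 1") (auto simp: a41_def)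
next
  case (Suc m)
  define s where "s = (2 * real k + 1) ^ 2"
  have s: "s > 0" by (simp add: s_def add_nonneg_pos)
  have "cf_tail a41 b41 (Suc k) m \<ge> 9 * s"
    using Suc.IH[of "Suc k"] by (simp add: s_def algebra_simps)
  then have "9 * s ^ 2 / cf_tail a41 b41 (Suc k) m \<le> 9 * s ^ 2 / (9 * s)"
    using s by (intro divide_left_mono mult_pos_pos) auto
  also have "\<dots> = s" using s by (simp add: power2_eq_square)
  finally have "b41 k / cf_tail a41 b41 (Suc k) m \<ge> - s"
    using Suc.prems by (simp add: b41_def s_def flip: power_mult)
  moreover have "a41 k - s \<ge> 9 * (2 * real k - 1) ^ 2"
    using Suc.prems by (cases "k = 1") (auto simp: a41_def s_def power2_eq_square algebra_simps)
  ultimately show ?case by simp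
qed

lemma cf_tail_41_nonzero: "k \<ge> 1 \<Longrightarrow> cf_tail a41 b41 k m \<noteq> 0"
proof -
  assume k: "k \<ge> 1"
  have "0 < 9 * (2 * real k - 1) ^ 2"
    using k by simp
  then show ?thesis using cf_tail_41_ge[OF k, of m] by linarith
qed

section \<open>Denominators, Casoratian and growth\<close>

fun den41 :: "nat \<Rightarrow> real" where
  "den41 0 = 1"
| "den41 (Suc 0) = a41 1"
| "den41 (Suc (Suc n)) = a41 (n + 2) * den41 (n + 1) + b41 (n + 1) * den41 n"

text \<open>The square of the double factorial (2n+1)!!.\<close>

definition sqprod :: "nat \<Rightarrow> real" where
  "sqprod n = (\<Prod>k<n. (2 * real k + 3) ^ 2)"

text \<open>The shift to n + 1 is needed because b(n+1) contains 2n + 3, matching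
  \<open>minsol_rec\<close> at n + 1. The remainder L q(n) - p(n) will turn out to be a multiple of
  this sequence.\<close>

definition res41 :: "nat \<Rightarrow> real" where
  "res41 n = sqprod n * minsol (n + 1)"

lemma sqprod_Suc: "sqprod (Suc n) = sqprod n * (2 * real n + 3) ^ 2"
  by (simp add: sqprod_def)

lemma sqprod_pos: "sqprod n > 0"
  unfolding sqprod_def by (intro prod_pos ballI zero_less_power) simp

lemma res41_pos: "res41 n > 0"
  unfolding res41_def by (intro mult_pos_pos sqprod_pos minsol_pos)

lemma res41_rec: "res41 (n + 2) = a41 (n + 2) * res41 (n + 1) + b41 (n + 1) * res41 n"
proof -
  have "res41 (n + 2) = sqprod n * (2 * real n + 3)^2 * ((2 * real (n + 1) + 3)^2 * minsol (n + 1 + 2))"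
    by (simp add: res41_def sqprod_Suc eval_nat_numeral)
  also have "\<dots> = (40 * (real n + 2)^2 + 2) * (sqprod n * (2 * real n + 3)^2 * minsol (n + 2))
      - 9 * ((2 * real n + 3)^2)^2 * (sqprod n * minsol (n + 1))"
    unfolding minsol_rec by (simp add: algebra_simps power2_eq_square)
  finally show ?thesis
    by (simp add: res41_def sqprod_Suc a41_def b41_def algebra_simps)
qed

text \<open>Each step multiplies the Casoratian by -b(n+1) = 9 (2n+3)^4. At n = 0 the exceptional
  value a(1) = 33 = 42 - 9 turns 33 \<open>minsol 1\<close> - 9 \<open>minsol 2\<close> into 9
  (\<open>minsol 0\<close> - \<open>minsol 1\<close>).\<close>

lemma casoratian_41:
  "res41 n * den41 (n + 1) - res41 (n + 1) * den41 n = 9 ^ (n + 1) * sqprod n ^ 2 * (minsol 0 - minsol 1)"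
proof (induction n)
  case 0
  have "9 * minsol 2 = 42 * minsol 1 - 9 * minsol 0"
    using minsol_rec[of 0] by (simp add: numeral_2_eq_2)
  then show ?case
    by (simp add: res41_def sqprod_def a41_def numeral_2_eq_2 algebra_simps)
next
  case (Suc n)
  have "res41 (Suc n) * den41 (Suc n + 1) - res41 (Suc n + 1) * den41 (Suc n) =
      - b41 (n + 1) * (res41 n * den41 (n + 1) - res41 (n + 1) * den41 n)"
    using res41_rec[of n] by (simp add: algebra_simps)
  also have "\<dots> = 9 ^ (Suc n + 1) * sqprod (Suc n) ^ 2 * (minsol 0 - minsol 1)"
    unfolding Suc.IH sqprod_Suc by (simp add: b41_def power_mult_distrib algebra_simps flip: power_mult)
  finally show ?case .
qed

text \<open>The distance to the fixed point c / (1 - r) contracts by r up to a perturbation that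
  tends to 0.\<close>

lemma tendsto_affine_recurrence:
  fixes y z :: "nat \<Rightarrow> real"
  assumes rec: "\<And>n. y (Suc n) = r * y n + z n" and r: "0 \<le> r" "r < 1" and z: "z \<longlonglongrightarrow> c"
  shows "y \<longlonglongrightarrow> c / (1 - r)"
proof -
  define d where "d n = \<bar>y n - c / (1 - r)\<bar>" for n
  have d_Suc: "d (Suc n) \<le> r * d n + \<bar>z n - c\<bar>" for n
  proof -
    have "y (Suc n) - c / (1 - r) = r * (y n - c / (1 - r)) + (z n - c)"
      unfolding rec using r(2) by (simp add: field_simps)
    then show ?thesis
      unfolding d_def using abs_triangle_ineq[of "r * (y n - c / (1 - r))" "z n - c"] r(1)
      by (simp add: abs_mult)
  qed
  have "d \<longlonglongrightarrow> 0"
  proof (rule LIMSEQ_I)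
    fix e :: real assume e: "e > 0"
    \<comment> \<open>Perturbations below \<open>e'\<close> accumulate, by the geometric series, to
      at most e' / (1 - r) = e / 2.\<close>
    define e' where "e' = e * (1 - r) / 2"
    have "e' > 0" using e r by (simp add: e'_def)
    then obtain N where N: "\<And>n. n \<ge> N \<Longrightarrow> \<bar>z n - c\<bar> < e'"
      using LIMSEQ_D[OF z] by force
    have bound: "d (N + k) \<le> r ^ k * d N + e / 2" for k
    proof (induction k)
      case (Suc k)
      have "d (N + Suc k) \<le> r * d (N + k) + e'"
        using d_Suc[of "N + k"] N[of "N + k"] by simp
      also have "\<dots> \<le> r * (r ^ k * d N + e / 2) + e'"
        using Suc r by (intro add_mono mult_left_mono) auto
      also have "\<dots> = r ^ Suc k * d N + e / 2"
        by (simp add: e'_def field_simps)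
      finally show ?case .
    qed (use e in simp)
    have "(\<lambda>k. r ^ k * d N) \<longlonglongrightarrow> 0"
      using r by (intro tendsto_mult_left_zero LIMSEQ_realpow_zero)
    then obtain K where K: "\<And>k. k \<ge> K \<Longrightarrow> \<bar>r ^ k * d N\<bar> < e / 2"
      using LIMSEQ_D[of _ 0 "e / 2"] e by force
    show "\<exists>no. \<forall>n\<ge>no. norm (d n - 0) < e"
    proof (intro exI[of _ "N + K"] allI impI)
      fix n assume n: "n \<ge> N + K"
      then have "d n \<le> r ^ (n - N) * d N + e / 2" and "\<bar>r ^ (n - N) * d N\<bar> < e / 2"
        using bound[of "n - N"] K[of "n - N"] by auto
      then have "d n < e" by linarith
      then show "norm (d n - 0) < e" by (simp add: d_def)
    qed
  qed
  then show ?thesis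
    unfolding d_def[abs_def] by (simp add: tendsto_rabs_zero_iff LIM_zero_iff)
qed

text \<open>Dividing the Casoratian by two consecutive values of \<open>res41\<close> gives y(n+1) =
  y(n) / 9 + z(n). By \<open>tendsto_minsol\<close>, z(n) tends to pi^2 / 4 times
  \<open>minsol 0 - minsol 1\<close>, and 1 / (1 - 1/9) = 9/8 supplies the rest.\<close>

lemma tendsto_den41_over_res41:
  "(\<lambda>n. den41 n / res41 n / 9 ^ n) \<longlonglongrightarrow> 9 * pi ^ 2 * (minsol 0 - minsol 1) / 32"
proof -
  define \<delta> where "\<delta> = minsol 0 - minsol 1"
  define y where "y n = den41 n / res41 n / 9 ^ n" for n
  define z where "z n = \<delta> / ((2 * real n + 3)^2 * minsol (n + 1) * minsol (n + 2))" for n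
  have "y (Suc n) = 1/9 * y n + z n" for n
  proof -
    have pos: "res41 n > 0" "res41 (n + 1) > 0" "sqprod n > 0" "minsol (n + 1) > 0" "minsol (n + 2) > 0"
      by (auto intro: res41_pos sqprod_pos minsol_pos)
    have "den41 (n + 1) / res41 (n + 1) - den41 n / res41 n = 
        (res41 n * den41 (n + 1) - res41 (n + 1) * den41 n) / (res41 n * res41 (n + 1))"
      using pos by (simp add: field_simps)
    also have "\<dots> = 9 ^ (n + 1) * z n"
    proof -
      have cancel: "e * s^2 * d / (s * f * (s * q * g)) = e * (d / (q * f * g))" if "s \<noteq> 0" for d e f g q s :: real
        using that by (simp add: power2_eq_square)
      have res: "res41 (n + 1) = sqprod n * (2 * real n + 3)^2 * minsol (n + 2)"
        by (simp add: res41_def sqprod_Suc)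
      show ?thesis
        unfolding casoratian_41 \<delta>_def[symmetric] unfolding res res41_def[of n] z_def
        by (rule cancel) (use pos in simp)
    qed
    finally show ?thesis by (simp add: y_def field_simps)
  qed
  moreover have "z \<longlonglongrightarrow> \<delta> / (2^2 * (1 / pi) * (1 / pi))"
  proof (rule Lim_transform_eventually)
    have 1: "(\<lambda>n. (2 * real n + 3) / real (n + 1)) \<longlonglongrightarrow> 2" "(\<lambda>n. real (n + 1) / real (n + 2)) \<longlonglongrightarrow> 1"
      by real_asymp+
    have 2: "(\<lambda>n. real (n + k) * minsol (n + k)) \<longlonglongrightarrow> 1 / pi" for k
      using LIMSEQ_ignore_initial_segment[OF tendsto_minsol] .
    show "(\<lambda>n. \<delta> / (((2 * real n + 3) / real (n + 1))^2 * (real (n + 1) * minsol (n + 1))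
         * (real (n + 2) * minsol (n + 2)) * (real (n + 1) / real (n + 2))))
         \<longlonglongrightarrow> \<delta> / (2^2 * (1 / pi) * (1 / pi))"
      by (rule tendsto_eq_intros 1 2 refl | simp)+
    show "\<forall>\<^sub>F n in sequentially. \<delta> / (((2 * real n + 3) / real (n + 1))^2 * (real (n + 1) * minsol (n + 1))
         * (real (n + 2) * minsol (n + 2)) * (real (n + 1) / real (n + 2))) = z n"
      by (intro always_eventually allI) (simp add: z_def power2_eq_square divide_simps)
  qed
  ultimately have "y \<longlonglongrightarrow> \<delta> / (2^2 * (1 / pi) * (1 / pi)) / (1 - 1/9)"
    by (intro tendsto_affine_recurrence) auto
  then show ?thesis
    unfolding y_def[abs_def] \<delta>_def by (simp add: power2_eq_square mult_ac)
qed

section \<open>Limit and error of the continued fraction\<close>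

theorem theorem4p1:
  defines "L \<equiv> 2 powr (-1/3) * (Gamma (1/3) / Gamma (2/3)) ^ 6 :: real"
  shows "cf_convergent a41 b41 \<longlonglongrightarrow> L \<and>
         (\<lambda>n. L - cf_convergent a41 b41 n) \<sim>[at_top] (\<lambda>n. 4 * L / 3 ^ (2 * n + 2))"
proof -
  define S \<delta> where "S = minsol 0" and "\<delta> = minsol 0 - minsol 1"
  define y where "y n = den41 n / res41 n / 9 ^ n" for n
  have pos: "L > 0" "S > 0"
    unfolding L_def S_def
    by (intro mult_pos_pos zero_less_power divide_pos_pos Gamma_real_pos minsol_pos; simp)+
  have S: "S = hsum (1/2) 1" by (simp add: S_def minsol_def)
  have \<delta>: "\<delta> = 3/4 * hsum (5/2) 2" unfolding \<delta>_def by (rule minsol_0_diff)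
  \<comment> \<open>The second identity makes the initial values of the numerators come out right
    and so identifies the limit; the first fixes the constant in the error.\<close>
  have S\<delta>: "S * \<delta> = 8 / pi ^ 2" and L\<delta>: "L * \<delta> = 36 * S"
    using hsum_evaluation unfolding S \<delta> L_def by (simp_all add: mult_ac)
  \<comment> \<open>Chosen so that L q(n) - p(n) is L / S times the minimal solution. Then p(0) = L
    \<delta> / S = 36 and p(1) = 42 * 36 = 33 * 36 + 324, so these are the numerators.\<close>
  define p where "p n = L * den41 n - L / S * res41 n" for n
  have rec: "minsol 1 = S - \<delta>" "9 * minsol 2 = 33 * S - 42 * \<delta>"
    using minsol_rec[of 0] by (auto simp: S_def \<delta>_def numeral_2_eq_2)
  have "p 0 = L * \<delta> / S"
    using pos by (simp add: p_def res41_def sqprod_def rec field_simps del: One_nat_def)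
  then have p0: "p 0 = a41 0"
    using pos by (simp add: L\<delta> a41_def)
  have "p 1 = 33 * L - L / S * (9 * minsol 2)"
    by (simp add: p_def res41_def sqprod_def a41_def numeral_2_eq_2)
  also have "\<dots> = 42 * (L * \<delta>) / S"
    unfolding rec using pos by (simp add: field_simps)
  finally have p1: "p 1 = a41 1 * a41 0 + b41 0"
    unfolding L\<delta> using pos by (simp add: a41_def b41_def)
  have p_rec: "\<forall>n. p (n + 2) = a41 (n + 2) * p (n + 1) + b41 (n + 1) * p n"
    unfolding p_def res41_rec by (simp add: algebra_simps)
  have conv: "cf_convergent a41 b41 n = p n / den41 n" and den: "den41 n \<noteq> 0" for n
    by (rule cf_convergent_eq[OF cf_tail_41_nonzero p0 p1 p_rec]; simp)+
  have y_nz: "y n \<noteq> 0" for n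
    using den[of n] res41_pos[of n] by (simp add: y_def)
  have err: "L - cf_convergent a41 b41 n = L / S / y n * (1/9) ^ n" for n
    using den[of n] res41_pos[of n] by (simp add: conv p_def y_def field_simps)
  have y: "y \<longlonglongrightarrow> 9 * pi ^ 2 * \<delta> / 32"
    unfolding y_def[abs_def] \<delta>_def by (rule tendsto_den41_over_res41)
  have \<delta>_nz: "\<delta> \<noteq> 0" using S\<delta> by auto
  have "(\<lambda>n. L - L / S / y n * (1/9) ^ n) \<longlonglongrightarrow> L - L / S / (9 * pi ^ 2 * \<delta> / 32) * 0"
    using pos \<delta>_nz by (intro tendsto_intros y LIMSEQ_realpow_zero) auto
  moreover have "L - L / S / y n * (1/9) ^ n = cf_convergent a41 b41 n" for n
    using err[of n] by linarith
  ultimately have "cf_convergent a41 b41 \<longlonglongrightarrow> L" by simp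
  moreover have "(\<lambda>n. L - cf_convergent a41 b41 n) \<sim>[at_top] (\<lambda>n. 4 * L / 3 ^ (2 * n + 2))"
  proof (rule asymp_equivI')
    have "(\<lambda>n. 9 / (4 * S * y n)) \<longlonglongrightarrow> 9 / (4 * S * (9 * pi ^ 2 * \<delta> / 32))"
      using pos \<delta>_nz by (intro tendsto_intros y) auto
    \<comment> \<open>With S \<delta> = 8 / pi^2 the right side is 1; this is where the factor 4 of
      the error term comes from.\<close>
    moreover have "9 / (4 * S * (9 * pi ^ 2 * \<delta> / 32)) = 8 / (pi ^ 2 * (S * \<delta>))"
      by (simp add: field_simps)
    moreover have "9 / (4 * S * y n) = (L - cf_convergent a41 b41 n) / (4 * L / 3 ^ (2 * n + 2))" for n
    proof -
      have "(3::real) ^ (2 * n + 2) = 9 * 9 ^ n" by (simp add: power_mult)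
      then show ?thesis
        unfolding err using pos y_nz[of n] by (simp add: power_divide field_simps)
    qed
    ultimately show "(\<lambda>n. (L - cf_convergent a41 b41 n) / (4 * L / 3 ^ (2 * n + 2))) \<longlonglongrightarrow> 1"
      unfolding S\<delta> by simp
  qed
  ultimately show ?thesis ..
qed

end
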